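(* Let $\mu$ be a product measure on $\mathbb{R}^d$, i.e. $d\mu(\mathbf{x})=\prod_{i=1}^d d\mu_i(x_i)$ with $\mu_1,\dots,\mu_d$ finite Borel measures on $\mathbb{R}$, such that $\langle p,q\rangle_\mu=\int pq\,d\mu$ is an inner product on $\mathbb{R}[\mathbf{x}]$. Then for all $n\in\mathbb{N}$ and all $\mathbf{x}\in\mathbb{R}^d$, $$\Lambda_{\otimes n}^{\mu}(\mathbf{x})=\prod_{i=1}^d\Lambda_n^{\mu_i}(x_i).$$
   Context: $\mathbb{R}[\mathbf{x}]=\mathbb{R}[x_1,\dots,x_d]$. For $n\in\mathbb{N}$, $\mathbb{R}[\mathbf{x}]_{\otimes n}$ is the subspace of polynomials of coordinate-wise degree at most $n$, i.e. spanned by the monomials $\mathbf{x}^\alpha$ with $\max_k\alpha_k\le n$. The coordinate-wise Christoffel polynomial of $\mu$ is $\Lambda_{\otimes n}^\mu(\mathbf{x})=\sum_{k=1}^{(n+1)^d}P_k(\mathbf{x})^2$, where $\{P_k\}$ is any orthonormal basis of $\mathbb{R}[\mathbf{x}]_{\otimes n}$ with respect to $\langle\cdot,\cdot\rangle_\mu$. For a measure $\mu_i$ on $\mathbb{R}$, the Christoffel polynomial is $\Lambda_n^{\mu_i}(x_i)=\sum_{j=0}^nP_{i,j}(x_i)^2$, where $\{P_{i,0},\dots,P_{i,n}\}$ is any orthonormal basis of the univariate polynomials of degree at most $n$ with respect to $\langle p,q\rangle_{\mu_i}=\int pq\,d\mu_i$. *)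

theory Defs
  imports "HOL-Analysis.Analysis" "HOL-Library.Poly_Mapping" "HOL-Computational_Algebra.Polynomial"
begin

section \<open>Inner products and orthonormal bases\<close>

text \<open>
  Neither \<open>real poly\<close> nor the type of multivariate polynomials below is an instance of
  \<open>real_vector\<close>, so the scalar multiplication is an explicit parameter, as in the locale
  \<open>vector_space\<close>.
\<close>

definition is_inner_product ::
    "(real \<Rightarrow> 'v \<Rightarrow> 'v::ab_group_add) \<Rightarrow> ('v \<Rightarrow> 'v \<Rightarrow> real) \<Rightarrow> bool" where
  "is_inner_product smul ip \<longleftrightarrow>
     (\<forall>p q. ip p q = ip q p) \<and>
     (\<forall>p q r. ip (p + q) r = ip p r + ip q r) \<and>
     (\<forall>c p q. ip (smul c p) q = c * ip p q) \<and>
     (\<forall>p. p \<noteq> 0 \<longrightarrow> 0 < ip p p)"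

definition orthonormal_basis ::
    "(real \<Rightarrow> 'v \<Rightarrow> 'v::ab_group_add) \<Rightarrow> ('v \<Rightarrow> 'v \<Rightarrow> real) \<Rightarrow> 'v set \<Rightarrow> nat set \<Rightarrow>
     (nat \<Rightarrow> 'v) \<Rightarrow> bool" where
  "orthonormal_basis smul ip V I P \<longleftrightarrow>
     inj_on P I \<and> \<not> module.dependent smul (P ` I) \<and> module.span smul (P ` I) = V \<and>
     (\<forall>i\<in>I. \<forall>j\<in>I. ip (P i) (P j) = (if i = j then 1 else 0))"

section \<open>Univariate polynomials\<close>

definition upoly_ip :: "real measure \<Rightarrow> real poly \<Rightarrow> real poly \<Rightarrow> real" where
  "upoly_ip \<nu> p q = (\<integral>t. poly p t * poly q t \<partial>\<nu>)"

text \<open>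
  The quantity described is the common value of \<open>\<Sum>j\<le>n. P\<^sub>j(t)\<^sup>2\<close> over all orthonormal
  bases \<open>P\<close>. Definite description is used instead of a choice of basis, so that the
  independence of the basis is part of the meaning; see \<open>christoffel_eq\<close> and
  \<open>tensor_christoffel_eq\<close>.
\<close>

definition christoffel :: "real measure \<Rightarrow> nat \<Rightarrow> real \<Rightarrow> real" where
  "christoffel \<nu> n t =
     (THE v. \<exists>P. orthonormal_basis smult (upoly_ip \<nu>) {p. degree p \<le> n} {0..n} P \<and>
        v = (\<Sum>j = 0..n. (poly (P j) t)\<^sup>2))"

section \<open>Multivariate polynomials\<close>

text \<open>
  The polynomial ring over the reals in the indeterminates indexed by \<open>'d\<close>, as the monoid
  algebra of the exponent vectors: a polynomial maps each exponent vector to its coefficient.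
\<close>

type_synonym 'd mpoly = "('d \<Rightarrow>\<^sub>0 nat) \<Rightarrow>\<^sub>0 real"

definition mpoly_scale :: "real \<Rightarrow> 'd mpoly \<Rightarrow> 'd mpoly" where
  "mpoly_scale c p = Poly_Mapping.single 0 c * p"

definition mpoly_eval :: "'d::finite mpoly \<Rightarrow> real ^ 'd \<Rightarrow> real" where
  "mpoly_eval p x =
     (\<Sum>\<alpha>\<in>Poly_Mapping.keys p. Poly_Mapping.lookup p \<alpha> *
        (\<Prod>k\<in>UNIV. (x $ k) ^ Poly_Mapping.lookup \<alpha> k))"

definition tensor_polys :: "nat \<Rightarrow> 'd::finite mpoly set" where
  "tensor_polys n =
     module.span mpoly_scale {Poly_Mapping.single \<alpha> 1 | \<alpha>. \<forall>k. Poly_Mapping.lookup \<alpha> k \<le> n}"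

definition mpoly_ip :: "(real ^ 'd::finite) measure \<Rightarrow> 'd mpoly \<Rightarrow> 'd mpoly \<Rightarrow> real" where
  "mpoly_ip \<mu> p q = (\<integral>x. mpoly_eval p x * mpoly_eval q x \<partial>\<mu>)"

text \<open>
  The Bochner integral of a non-integrable function is 0, so the existence of the integrals
  defining the form has to be required separately.
\<close>

definition mpoly_inner_product :: "(real ^ 'd::finite) measure \<Rightarrow> bool" where
  "mpoly_inner_product \<mu> \<longleftrightarrow>
     (\<forall>p q. integrable \<mu> (\<lambda>x. mpoly_eval p x * mpoly_eval q x)) \<and>
     is_inner_product mpoly_scale (mpoly_ip \<mu>)"

definition tensor_christoffel :: "(real ^ 'd::finite) measure \<Rightarrow> nat \<Rightarrow> real ^ 'd \<Rightarrow> real" where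
  "tensor_christoffel \<mu> n x =
     (THE v. \<exists>P. orthonormal_basis mpoly_scale (mpoly_ip \<mu>) (tensor_polys n)
                  {1..(n + 1) ^ CARD('d)} P \<and>
        v = (\<Sum>k = 1..(n + 1) ^ CARD('d). (mpoly_eval (P k) x)\<^sup>2))"

section \<open>Product measures\<close>

text \<open>The product measure of the library lives on functions; it is transported to vectors.\<close>

definition vec_product_measure :: "('d::finite \<Rightarrow> real measure) \<Rightarrow> (real ^ 'd) measure" where
  "vec_product_measure \<nu> = distr (PiM UNIV \<nu>) borel (\<lambda>f. \<chi> i. f i)"

section \<open>Christoffel polynomials are well defined\<close>

lemma is_inner_productD:
  assumes "is_inner_product smul ip"
  shows "ip p q = ip q p" "ip (p + q) r = ip p r + ip q r" "ip r (p + q) = ip r p + ip r q"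
    "ip (smul c p) q = c * ip p q" "ip q (smul c p) = c * ip q p" "p \<noteq> 0 \<Longrightarrow> 0 < ip p p"
  using assms unfolding is_inner_product_def by metis+

lemma is_inner_product_sum:
  assumes "vector_space smul" "is_inner_product smul ip"
  shows "ip (\<Sum>i\<in>A. f i) q = (\<Sum>i\<in>A. ip (f i) q)"
proof -
  interpret vector_space smul by fact
  have "ip 0 q = 0"
    using is_inner_productD(4)[OF assms(2), of 0 0 q] by simp
  then show ?thesis
    by (induction A rule: infinite_finite_induct)
       (simp_all add: is_inner_productD(2)[OF assms(2)])
qed

lemma orthonormal_expansion:
  assumes "vector_space smul" "is_inner_product smul ip" "finite I"
    and P: "orthonormal_basis smul ip V I P" and v: "v \<in> V"
  shows "v = (\<Sum>i\<in>I. smul (ip v (P i)) (P i))"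
proof -
  interpret vector_space smul by fact
  have inj: "inj_on P I" and sp: "v \<in> span (P ` I)"
    using P v by (auto simp: orthonormal_basis_def)
  from sp obtain u where "v = (\<Sum>w\<in>P ` I. smul (u w) w)"
    using span_finite[of "P ` I"] assms(3) by auto
  then have e: "v = (\<Sum>i\<in>I. smul (u (P i)) (P i))"
    using inj by (simp add: sum.reindex)
  have "ip v (P j) = u (P j)" if j: "j \<in> I" for j
  proof -
    have "ip v (P j) = (\<Sum>i\<in>I. u (P i) * ip (P i) (P j))"
      by (subst e)
         (simp add: is_inner_product_sum[OF assms(1,2)] is_inner_productD(4)[OF assms(2)])
    also have "\<dots> = (\<Sum>i\<in>I. if j = i then u (P i) else 0)"
      using P j by (intro sum.cong) (auto simp: orthonormal_basis_def)
    also have "\<dots> = u (P j)"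
      using j assms(3) by simp
    finally show ?thesis .
  qed
  then have "(\<Sum>i\<in>I. smul (ip v (P i)) (P i)) = (\<Sum>i\<in>I. smul (u (P i)) (P i))"
    by (intro sum.cong) auto
  then show ?thesis
    using e by simp
qed

lemma orthonormal_sum_squares_unique:
  assumes vs: "vector_space smul" and ip: "is_inner_product smul ip" and fin: "finite I"
    and P: "orthonormal_basis smul ip V I P" and Q: "orthonormal_basis smul ip V I Q"
    and ev_add: "\<And>p q. ev (p + q) = (ev p + ev q :: real)"
    and ev_scale: "\<And>c p. ev (smul c p) = c * ev p"
  shows "(\<Sum>i\<in>I. (ev (P i))\<^sup>2) = (\<Sum>i\<in>I. (ev (Q i))\<^sup>2)"
proof -
  interpret vector_space smul by fact
  have ev0: "ev 0 = 0"
    using ev_scale[of 0 0] by simp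
  have ev_sum: "ev (\<Sum>i\<in>A. f i) = (\<Sum>i\<in>A. ev (f i))" for f and A :: "nat set"
    by (induction A rule: infinite_finite_induct) (simp_all add: ev0 ev_add)
  have mem: "P i \<in> V" "Q i \<in> V" if "i \<in> I" for i
    using span_base[of "P i" "P ` I"] span_base[of "Q i" "Q ` I"] P Q that
    by (simp_all add: orthonormal_basis_def)
  have eP: "ev (P i) = (\<Sum>j\<in>I. ip (P i) (Q j) * ev (Q j))" if "i \<in> I" for i
    using arg_cong[OF orthonormal_expansion[OF vs ip fin Q mem(1)[OF that]], of ev]
    by (simp add: ev_sum ev_scale)
  have eQ: "ev (Q j) = (\<Sum>i\<in>I. ip (P i) (Q j) * ev (P i))" if "j \<in> I" for j
    using arg_cong[OF orthonormal_expansion[OF vs ip fin P mem(2)[OF that]], of ev]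
    by (simp add: ev_sum ev_scale is_inner_productD(1)[OF ip, of "Q j"])
  have "(\<Sum>i\<in>I. (ev (P i))\<^sup>2) = (\<Sum>i\<in>I. \<Sum>j\<in>I. ip (P i) (Q j) * ev (Q j) * ev (P i))"
    unfolding power2_eq_square
    by (intro sum.cong refl) (subst eP, assumption, simp add: sum_distrib_right)
  also have "\<dots> = (\<Sum>j\<in>I. \<Sum>i\<in>I. ip (P i) (Q j) * ev (Q j) * ev (P i))"
    by (rule sum.swap)
  also have "\<dots> = (\<Sum>j\<in>I. ev (Q j) * (\<Sum>i\<in>I. ip (P i) (Q j) * ev (P i)))"
    by (simp add: sum_distrib_left mult_ac)
  also have "\<dots> = (\<Sum>j\<in>I. (ev (Q j))\<^sup>2)"
    unfolding power2_eq_square by (intro sum.cong refl) (simp add: eQ[symmetric])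
  finally show ?thesis .
qed

lemma orthonormal_independent:
  assumes vs: "vector_space smul" and ip: "is_inner_product smul ip"
    and orth: "\<forall>i\<in>I. \<forall>j\<in>I. ip (P i) (P j) = (if i = j then 1 else 0)" and fin: "finite I"
  shows "inj_on P I \<and> \<not> module.dependent smul (P ` I)"
proof -
  interpret vector_space smul by fact
  have inj: "inj_on P I"
    using orth by (metis (full_types) inj_onI zero_neq_one)
  have "u (P j) = 0" if s: "(\<Sum>v\<in>P ` I. smul (u v) v) = 0" and j: "j \<in> I" for u j
  proof -
    have "0 = ip (\<Sum>i\<in>I. smul (u (P i)) (P i)) (P j)"
      using s inj is_inner_productD(4)[OF ip, of 0 0 "P j"] by (simp add: sum.reindex)
    also have "\<dots> = (\<Sum>i\<in>I. if j = i then u (P i) else 0)"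
      unfolding is_inner_product_sum[OF vs ip] is_inner_productD(4)[OF ip]
      using orth j by (intro sum.cong) auto
    finally show ?thesis
      using j fin by simp
  qed
  then have "independent (P ` I)"
    using fin by (intro independent_if_scalars_zero) (auto simp: image_iff)
  with inj show ?thesis by simp
qed

lemma orthonormal_basis_exists_lessThan:
  assumes vs: "vector_space smul" and ip: "is_inner_product smul ip"
    and "finite B" "\<not> module.dependent smul B"
  shows "\<exists>P. orthonormal_basis smul ip (module.span smul B) {..<card B} P"
  using assms(3,4)
proof (induction B rule: finite_induct)
  interpret vector_space smul by fact
  case empty
  then show ?case
    by (auto simp: orthonormal_basis_def)
next
  interpret vector_space smul by fact
  case (insert b B)
  let ?n = "card B"
  have ind: "independent B" and b: "b \<notin> span B"
    using insert.prems insert.hyps independent_insert[of b B] by auto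
  obtain P where P: "orthonormal_basis smul ip (span B) {..<?n} P"
    using insert.IH[OF ind] by blast
  have orth: "ip (P i) (P j) = (if i = j then 1 else 0)" if "i < ?n" "j < ?n" for i j
    using P that by (auto simp: orthonormal_basis_def)
  have sp: "span (P ` {..<?n}) = span B"
    using P by (simp add: orthonormal_basis_def)
  define s where "s = (\<Sum>i<?n. smul (ip b (P i)) (P i))"
  define w where "w = b - s"
  have "s \<in> span (P ` {..<?n})"
    unfolding s_def by (intro span_sum span_scale span_base) auto
  then have s: "s \<in> span B" using sp by simp
  have "w \<noteq> 0"
    using b s by (auto simp: w_def)
  then have pos: "0 < ip w w"
    by (rule is_inner_productD(6)[OF ip])
  have wP: "ip w (P j) = 0" if j: "j < ?n" for j
  proof -
    have "ip s (P j) = (\<Sum>i<?n. if j = i then ip b (P i) else 0)"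
      unfolding s_def is_inner_product_sum[OF vs ip] is_inner_productD(4)[OF ip]
      using orth j by (intro sum.cong) auto
    then have "ip s (P j) = ip b (P j)"
      using j by simp
    moreover have "ip b (P j) = ip w (P j) + ip s (P j)"
      using is_inner_productD(2)[OF ip, of w s "P j"] by (simp add: w_def)
    ultimately show ?thesis by simp
  qed
  define c where "c = 1 / sqrt (ip w w)"
  have c: "c \<noteq> 0" "c * (c * ip w w) = 1"
    using pos by (auto simp: c_def field_simps)
  define e where "e = smul c w"
  have ee: "ip e e = 1"
    using c by (simp add: e_def is_inner_productD(4,5)[OF ip])
  have eP: "ip e (P j) = 0" "ip (P j) e = 0" if "j < ?n" for j
    using wP[OF that] is_inner_productD(1)[OF ip, of "P j" w]
    by (simp_all add: e_def is_inner_productD(4,5)[OF ip])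
  let ?Q = "\<lambda>i. if i = ?n then e else P i"
  have orthQ: "\<forall>i\<in>{..<Suc ?n}. \<forall>j\<in>{..<Suc ?n}. ip (?Q i) (?Q j) = (if i = j then 1 else 0)"
    using ee eP orth by (auto simp: less_Suc_eq)
  have im: "?Q ` {..<Suc ?n} = insert e (P ` {..<?n})"
    by (auto simp: lessThan_Suc)
  have eB: "e \<in> span (insert b B)"
    unfolding e_def w_def using s span_mono[of B "insert b B"]
    by (intro span_scale span_diff) (auto intro: span_base)
  have bE: "b \<in> span (insert e (P ` {..<?n}))"
  proof -
    have "smul (1 / c) e = w"
      using c(1) by (simp add: e_def)
    then have "b = smul (1 / c) e + s"
      by (simp add: w_def)
    moreover have "s \<in> span (insert e (P ` {..<?n}))"
      using s sp span_mono[of "P ` {..<?n}" "insert e (P ` {..<?n})"] by auto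
    ultimately show ?thesis
      by (metis insertI1 span_add span_base span_scale)
  qed
  have "insert e (P ` {..<?n}) \<subseteq> span (insert b B)"
    using eB sp span_superset[of "P ` {..<?n}"] span_mono[of B "insert b B"] by auto
  moreover have "insert b B \<subseteq> span (insert e (P ` {..<?n}))"
    using bE sp span_superset[of B] span_mono[of "P ` {..<?n}" "insert e (P ` {..<?n})"] by auto
  ultimately have "span (insert e (P ` {..<?n})) = span (insert b B)"
    by (simp add: span_minimal subspace_span subset_antisym)
  then have "orthonormal_basis smul ip (span (insert b B)) {..<Suc ?n} ?Q"
    using orthQ orthonormal_independent[OF vs ip orthQ]
    unfolding orthonormal_basis_def im by simp
  then show ?case
    using insert.hyps by auto
qed

lemma orthonormal_basis_exists:
  assumes vs: "vector_space smul" and ip: "is_inner_product smul ip"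
    and B: "finite B" "\<not> module.dependent smul B" and I: "finite I" "card I = card B"
  shows "\<exists>P. orthonormal_basis smul ip (module.span smul B) I P"
proof -
  obtain P where P: "orthonormal_basis smul ip (module.span smul B) {..<card B} P"
    using orthonormal_basis_exists_lessThan[OF vs ip B] by blast
  obtain h where h: "bij_betw h I {..<card B}"
    using I by (metis card_lessThan finite_lessThan finite_same_card_bij)
  have im: "(P \<circ> h) ` I = P ` {..<card B}"
    using h by (metis image_comp bij_betw_imp_surj_on)
  have "orthonormal_basis smul ip (module.span smul B) I (P \<circ> h)"
    unfolding orthonormal_basis_def im
  proof (intro conjI ballI)
    show "inj_on (P \<circ> h) I"
      using P h by (auto simp: orthonormal_basis_def bij_betw_def intro: comp_inj_on)
    fix i j assume "i \<in> I" "j \<in> I"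
    then have "h i \<in> {..<card B}" "h j \<in> {..<card B}" "h i = h j \<longleftrightarrow> i = j"
      using h by (auto simp: bij_betw_def inj_on_eq_iff)
    then show "ip ((P \<circ> h) i) ((P \<circ> h) j) = (if i = j then 1 else 0)"
      using P by (simp add: orthonormal_basis_def)
  qed (use P in \<open>auto simp: orthonormal_basis_def\<close>)
  then show ?thesis by blast
qed

lemma vector_space_smult: "vector_space (smult :: real \<Rightarrow> real poly \<Rightarrow> real poly)"
  by unfold_locales (simp_all add: smult_add_right smult_add_left)

lemma vector_space_mpoly_scale: "vector_space (mpoly_scale :: real \<Rightarrow> 'd mpoly \<Rightarrow> 'd mpoly)"
  by unfold_locales
     (simp_all add: mpoly_scale_def distrib_left distrib_right single_add mult.assoc[symmetric]
       mult_single)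

lemma lookup_mpoly_scale:
  "Poly_Mapping.lookup (mpoly_scale c p) \<alpha> = c * Poly_Mapping.lookup p \<alpha>"
  unfolding mpoly_scale_def mult_map_scale_conv_mult[symmetric]
  by (simp add: map.rep_eq when_def)

lemma mpoly_eval_superset:
  assumes "finite A" "Poly_Mapping.keys p \<subseteq> A"
  shows "mpoly_eval p x = (\<Sum>\<alpha>\<in>A. Poly_Mapping.lookup p \<alpha> *
    (\<Prod>k\<in>UNIV. (x $ k) ^ Poly_Mapping.lookup \<alpha> k))"
  unfolding mpoly_eval_def using assms
  by (intro sum.mono_neutral_left) (auto simp: in_keys_iff)

lemma mpoly_eval_add: "mpoly_eval (p + q) x = mpoly_eval p x + mpoly_eval q x"
proof -
  let ?A = "Poly_Mapping.keys p \<union> Poly_Mapping.keys q"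
  have "Poly_Mapping.keys (p + q) \<subseteq> ?A"
    by (rule Poly_Mapping.keys_add)
  then show ?thesis
    by (simp add: mpoly_eval_superset[of ?A] lookup_add distrib_right sum.distrib)
qed

lemma mpoly_eval_scale: "mpoly_eval (mpoly_scale c p) x = c * mpoly_eval p x"
proof -
  have "Poly_Mapping.keys (mpoly_scale c p) \<subseteq> Poly_Mapping.keys p"
    by (auto simp: in_keys_iff lookup_mpoly_scale)
  then show ?thesis
    by (simp add: mpoly_eval_superset[of "Poly_Mapping.keys p"] lookup_mpoly_scale
        sum_distrib_left mult.assoc)
qed

lemma christoffel_basis_exists:
  assumes "is_inner_product smult (upoly_ip \<nu>)"
  shows "\<exists>P. orthonormal_basis smult (upoly_ip \<nu>) {p. degree p \<le> n} {0..n} P"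
proof -
  interpret vector_space "smult :: real \<Rightarrow> real poly \<Rightarrow> real poly"
    by (rule vector_space_smult)
  let ?m = "\<lambda>j. monom (1::real) j"
  let ?B = "?m ` {0..n}"
  have inj: "inj_on ?m {0..n}"
    by (auto simp: inj_on_def monom_eq_iff')
  have coeff_s: "coeff (\<Sum>j = 0..n. smult (u j) (?m j)) i = (if i \<le> n then u i else 0)" for u i
    by (simp add: coeff_sum smult_monom)
  have ind: "independent ?B"
  proof (rule independent_if_scalars_zero)
    fix u v assume s: "(\<Sum>w\<in>?B. smult (u w) w) = 0" and "v \<in> ?B"
    then obtain i where i: "i \<le> n" "v = ?m i" by auto
    have "(\<Sum>j = 0..n. smult (u (?m j)) (?m j)) = 0"
      using s inj by (simp add: sum.reindex)
    then show "u v = 0"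
      using coeff_s[of "\<lambda>j. u (?m j)" i] i by simp
  qed simp
  have sp: "span ?B = {p. degree p \<le> n}"
  proof (intro subset_antisym subsetI CollectI)
    fix p assume "p \<in> span ?B"
    then obtain u where "p = (\<Sum>w\<in>?B. smult (u w) w)"
      using span_finite[of ?B] by auto
    then have "p = (\<Sum>j = 0..n. smult (u (?m j)) (?m j))"
      using inj by (simp add: sum.reindex)
    then show "degree p \<le> n"
      using coeff_s[of "\<lambda>j. u (?m j)"] by (intro degree_le) auto
  next
    fix p :: "real poly" assume "p \<in> {p. degree p \<le> n}"
    then have "p = (\<Sum>j = 0..n. smult (coeff p j) (?m j))"
      by (intro poly_eqI) (auto simp: coeff_s coeff_eq_0)
    also have "\<dots> \<in> span ?B"
      by (intro span_sum span_scale span_base) auto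
    finally show "p \<in> span ?B" .
  qed
  show ?thesis
    using orthonormal_basis_exists[OF vector_space_smult assms, of ?B "{0..n}"] inj ind sp
    by (simp add: card_image)
qed

lemma christoffel_eq:
  assumes "is_inner_product smult (upoly_ip \<nu>)"
    and "orthonormal_basis smult (upoly_ip \<nu>) {p. degree p \<le> n} {0..n} P"
  shows "christoffel \<nu> n t = (\<Sum>j = 0..n. (poly (P j) t)\<^sup>2)"
  unfolding christoffel_def using assms(2)
  by (blast intro: the_equality
      orthonormal_sum_squares_unique[OF vector_space_smult assms(1), where ev = "\<lambda>p. poly p t"]
      finite_atLeastAtMost poly_add poly_smult)

lemma card_bounded_exponents:
  "finite {\<alpha> :: 'd::finite \<Rightarrow>\<^sub>0 nat. \<forall>k. Poly_Mapping.lookup \<alpha> k \<le> n}"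
  "card {\<alpha> :: 'd::finite \<Rightarrow>\<^sub>0 nat. \<forall>k. Poly_Mapping.lookup \<alpha> k \<le> n} = (n + 1) ^ CARD('d)"
proof -
  let ?E = "{\<alpha> :: 'd \<Rightarrow>\<^sub>0 nat. \<forall>k. Poly_Mapping.lookup \<alpha> k \<le> n}"
  let ?F = "PiE (UNIV :: 'd set) (\<lambda>_. {0..n})"
  have "bij_betw Poly_Mapping.lookup ?E ?F"
  proof (rule bij_betwI[where g = Abs_poly_mapping])
    show "Abs_poly_mapping \<in> ?F \<rightarrow> ?E"
      by (auto simp: Abs_poly_mapping_inverse PiE_iff)
  qed (auto simp: lookup_inverse Abs_poly_mapping_inverse)
  moreover have "finite ?F"
    by (intro finite_PiE) auto
  moreover have "card ?F = (n + 1) ^ CARD('d)"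
    by (simp add: card_PiE)
  ultimately show "finite ?E" "card ?E = (n + 1) ^ CARD('d)"
    by (simp_all add: bij_betw_finite bij_betw_same_card)
qed

lemma tensor_christoffel_basis_exists:
  fixes \<mu> :: "(real ^ 'd::finite) measure"
  assumes "is_inner_product mpoly_scale (mpoly_ip \<mu>)"
  shows "\<exists>P. orthonormal_basis mpoly_scale (mpoly_ip \<mu>) (tensor_polys n)
           {1..(n + 1) ^ CARD('d)} P"
proof -
  interpret vector_space "mpoly_scale :: real \<Rightarrow> 'd mpoly \<Rightarrow> 'd mpoly"
    by (rule vector_space_mpoly_scale)
  let ?E = "{\<alpha> :: 'd \<Rightarrow>\<^sub>0 nat. \<forall>k. Poly_Mapping.lookup \<alpha> k \<le> n}"
  let ?m = "\<lambda>\<alpha> :: 'd \<Rightarrow>\<^sub>0 nat. Poly_Mapping.single \<alpha> (1::real)"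
  have inj: "inj_on ?m A" for A
    by (auto simp: inj_on_def) (metis lookup_single_eq lookup_single_not_eq zero_neq_one)
  have fin: "finite ?E" and crd: "card ?E = (n + 1) ^ CARD('d)"
    by (rule card_bounded_exponents)+
  have ind: "independent (?m ` ?E)"
  proof (rule independent_if_scalars_zero)
    fix u v assume s: "(\<Sum>w\<in>?m ` ?E. mpoly_scale (u w) w) = 0" and "v \<in> ?m ` ?E"
    then obtain \<alpha> where \<alpha>: "\<alpha> \<in> ?E" "v = ?m \<alpha>" by blast
    have "0 = Poly_Mapping.lookup (\<Sum>\<beta>\<in>?E. mpoly_scale (u (?m \<beta>)) (?m \<beta>)) \<alpha>"
      using s inj[of ?E] by (simp add: sum.reindex)
    also have "\<dots> = (\<Sum>\<beta>\<in>?E. if \<alpha> = \<beta> then u (?m \<beta>) else 0)"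
      unfolding lookup_sum lookup_mpoly_scale
      by (intro sum.cong) (auto simp: lookup_single when_def)
    also have "\<dots> = u (?m \<alpha>)"
      using fin \<alpha>(1) by (simp only: sum.delta' if_True)
    finally show "u v = 0"
      using \<alpha>(2) by simp
  qed (use fin in simp)
  have "tensor_polys n = span (?m ` ?E)"
    unfolding tensor_polys_def by (simp add: image_Collect)
  then show ?thesis
    using orthonormal_basis_exists[OF vector_space_mpoly_scale assms, of "?m ` ?E"
        "{1..(n + 1) ^ CARD('d)}"] inj[of ?E] ind fin crd
    by (simp add: card_image)
qed

lemma tensor_christoffel_eq:
  fixes \<mu> :: "(real ^ 'd::finite) measure"
  assumes "is_inner_product mpoly_scale (mpoly_ip \<mu>)"
    and "orthonormal_basis mpoly_scale (mpoly_ip \<mu>) (tensor_polys n) {1..(n + 1) ^ CARD('d)} P"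
  shows "tensor_christoffel \<mu> n x = (\<Sum>k = 1..(n + 1) ^ CARD('d). (mpoly_eval (P k) x)\<^sup>2)"
  unfolding tensor_christoffel_def using assms(2)
  by (blast intro: the_equality
      orthonormal_sum_squares_unique[OF vector_space_mpoly_scale assms(1),
        where ev = "\<lambda>p. mpoly_eval p x"]
      finite_atLeastAtMost mpoly_eval_add mpoly_eval_scale)

end

theory Submission
  imports Defs
begin

text \<open>
  A family of univariate polynomials \<open>p\<^sub>i\<close> has a tensor product, the multivariate polynomial
  \<open>\<Prod>\<^sub>i p\<^sub>i(x\<^sub>i)\<close>. By Fubini the inner product of two such polynomials with respect to a product
  measure is the product of the univariate inner products. Hence, if \<open>P\<^sub>i\<^sub>,\<^sub>0, \<dots>, P\<^sub>i\<^sub>,\<^sub>n\<close> is an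
  orthonormal basis for \<open>\<mu>\<^sub>i\<close>, the \<open>(n + 1)\<^sup>d\<close> tensor products \<open>\<Prod>\<^sub>i P\<^sub>i\<^sub>,\<^sub>F\<^sub>(\<^sub>i\<^sub>)(x\<^sub>i)\<close>, one for
  every index function \<open>F\<close>, are orthonormal. They span the polynomials of coordinate-wise
  degree at most \<open>n\<close>: a monomial is a tensor product of univariate monomials, and expanding
  each of these in its own basis and multiplying out gives a combination of the \<open>P\<^sub>F\<close>
  (\<open>orthonormal_basis_tensor_poly\<close>). As the Christoffel polynomial may be computed from any
  orthonormal basis, the theorem is the distributive law
  \<open>\<Sum>\<^sub>F \<Prod>\<^sub>i P\<^sub>i\<^sub>,\<^sub>F\<^sub>(\<^sub>i\<^sub>)(x\<^sub>i)\<^sup>2 = \<Prod>\<^sub>i \<Sum>\<^sub>j P\<^sub>i\<^sub>,\<^sub>j(x\<^sub>i)\<^sup>2\<close>.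

  The univariate bases exist only if every factor \<open>\<mu>\<^sub>i\<close> has all moments and induces an inner
  product. Both facts are inherited from the product measure, by looking at tensor products in
  which all but one component are 1 (\<open>integrable_poly_factor\<close>, \<open>is_inner_product_factor\<close>).
  This uses that no factor has mass 0 (\<open>factor_mass_nonzero\<close>).
\<close>

section \<open>Tensor products of univariate polynomials\<close>

definition tensor_poly :: "('d::finite \<Rightarrow> real poly) \<Rightarrow> 'd mpoly" where
  "tensor_poly p = Abs_poly_mapping (\<lambda>\<alpha>. \<Prod>i\<in>UNIV. coeff (p i) (Poly_Mapping.lookup \<alpha> i))"

lemma lookup_tensor_poly:
  "Poly_Mapping.lookup (tensor_poly p) \<alpha> = (\<Prod>i\<in>UNIV. coeff (p i) (Poly_Mapping.lookup \<alpha> i))"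
proof -
  define N where "N = Max (range (\<lambda>i. degree (p i)))"
  have N: "degree (p i) \<le> N" for i
    unfolding N_def by (intro Max_ge) auto
  let ?c = "\<lambda>\<alpha> :: 'a \<Rightarrow>\<^sub>0 nat. \<Prod>i\<in>UNIV. coeff (p i) (Poly_Mapping.lookup \<alpha> i)"
  have "{\<alpha>. ?c \<alpha> \<noteq> 0} \<subseteq> {\<alpha>. \<forall>k. Poly_Mapping.lookup \<alpha> k \<le> N}"
    using N by (auto intro: order.trans[OF le_degree])
  then have "finite {\<alpha>. ?c \<alpha> \<noteq> 0}"
    using card_bounded_exponents(1) by (rule finite_subset)
  then show ?thesis
    by (simp add: tensor_poly_def Abs_poly_mapping_inverse)
qed

lemma bij_betw_lookup_bounded:
  "bij_betw Poly_Mapping.lookup {\<alpha> :: 'd::finite \<Rightarrow>\<^sub>0 nat. \<forall>k. Poly_Mapping.lookup \<alpha> k \<le> n}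
     (PiE UNIV (\<lambda>_. {0..n}))"
proof (rule bij_betwI[where g = Abs_poly_mapping])
  show "Abs_poly_mapping \<in> PiE UNIV (\<lambda>_. {0..n}) \<rightarrow>
      {\<alpha> :: 'd \<Rightarrow>\<^sub>0 nat. \<forall>k. Poly_Mapping.lookup \<alpha> k \<le> n}"
    by (auto simp: Abs_poly_mapping_inverse PiE_iff)
qed (auto simp: lookup_inverse Abs_poly_mapping_inverse)

lemma mpoly_eval_tensor_poly: "mpoly_eval (tensor_poly p) x = (\<Prod>i\<in>UNIV. poly (p i) (x $ i))"
proof -
  define N where "N = Max (range (\<lambda>i. degree (p i)))"
  have N: "degree (p i) \<le> N" for i
    unfolding N_def by (intro Max_ge) auto
  let ?E = "{\<alpha> :: 'a \<Rightarrow>\<^sub>0 nat. \<forall>k. Poly_Mapping.lookup \<alpha> k \<le> N}"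
  have "Poly_Mapping.keys (tensor_poly p) \<subseteq> ?E"
    by (auto simp: in_keys_iff lookup_tensor_poly) (metis N le_degree order.trans)
  then have "mpoly_eval (tensor_poly p) x =
      (\<Sum>\<alpha>\<in>?E. \<Prod>i\<in>UNIV. coeff (p i) (Poly_Mapping.lookup \<alpha> i) *
        (x $ i) ^ Poly_Mapping.lookup \<alpha> i)"
    by (subst mpoly_eval_superset[OF card_bounded_exponents(1)])
       (simp_all add: lookup_tensor_poly prod.distrib)
  also have "\<dots> = (\<Sum>a\<in>PiE UNIV (\<lambda>_. {0..N}). \<Prod>i\<in>UNIV. coeff (p i) (a i) * (x $ i) ^ a i)"
    by (rule sum.reindex_bij_betw[OF bij_betw_lookup_bounded])
  also have "\<dots> = (\<Prod>i\<in>UNIV. \<Sum>j = 0..N. coeff (p i) j * (x $ i) ^ j)"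
    by (rule prod_sum_PiE[symmetric]) auto
  also have "\<dots> = (\<Prod>i\<in>UNIV. poly (p i) (x $ i))"
    using N unfolding poly_altdef
    by (intro prod.cong sum.mono_neutral_right refl) (auto intro: coeff_eq_0 order.trans[OF _ N])
  finally show ?thesis .
qed

lemma tensor_poly_nonzero:
  assumes "\<And>i. p i \<noteq> 0"
  shows "tensor_poly p \<noteq> 0"
proof
  let ?\<alpha> = "Abs_poly_mapping (\<lambda>i. degree (p i))"
  assume "tensor_poly p = 0"
  then have "(\<Prod>i\<in>UNIV. coeff (p i) (Poly_Mapping.lookup ?\<alpha> i)) = 0"
    using lookup_tensor_poly[of p ?\<alpha>] by simp
  then show False
    using assms by (simp add: Abs_poly_mapping_inverse)
qed

text \<open>Multiplying out: the tensor product is linear in each component.\<close>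

lemma tensor_poly_sum:
  assumes "\<And>i. finite (B i)"
  shows "tensor_poly (\<lambda>i. \<Sum>j\<in>B i. smult (c i j) (q i j)) =
    (\<Sum>F\<in>PiE UNIV B. mpoly_scale (\<Prod>i\<in>UNIV. c i (F i)) (tensor_poly (\<lambda>i. q i (F i))))"
  using assms
  by (intro poly_mapping_eqI)
     (simp add: lookup_tensor_poly lookup_sum lookup_mpoly_scale coeff_sum prod_sum_PiE
       prod.distrib)

lemma single_eq_tensor_poly:
  "Poly_Mapping.single \<alpha> 1 = tensor_poly (\<lambda>i. monom 1 (Poly_Mapping.lookup \<alpha> i))"
proof (rule poly_mapping_eqI)
  fix \<beta>
  show "Poly_Mapping.lookup (Poly_Mapping.single \<alpha> 1) \<beta> =
      Poly_Mapping.lookup (tensor_poly (\<lambda>i. monom 1 (Poly_Mapping.lookup \<alpha> i))) \<beta>"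
  proof (cases "\<alpha> = \<beta>")
    case False
    then obtain i where "Poly_Mapping.lookup \<alpha> i \<noteq> Poly_Mapping.lookup \<beta> i"
      by (metis poly_mapping_eqI)
    then have "(\<Prod>i\<in>UNIV. coeff (monom (1::real) (Poly_Mapping.lookup \<alpha> i))
        (Poly_Mapping.lookup \<beta> i)) = 0"
      by (intro prod_zero bexI[of _ i]) auto
    then show ?thesis
      using False by (simp only: lookup_tensor_poly lookup_single when_def if_False)
  qed (simp add: lookup_tensor_poly)
qed

lemma tensor_poly_in_tensor_polys:
  assumes "\<And>i. degree (p i) \<le> n"
  shows "tensor_poly p \<in> tensor_polys n"
proof -
  interpret vector_space "mpoly_scale :: real \<Rightarrow> 'a mpoly \<Rightarrow> 'a mpoly"
    by (rule vector_space_mpoly_scale)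
  have "p = (\<lambda>i. \<Sum>j = 0..n. smult (coeff (p i) j) (monom 1 j))"
    by (intro ext poly_eqI)
       (auto simp: coeff_sum smult_monom not_le intro: coeff_eq_0 le_less_trans[OF assms])
  then have "tensor_poly p = tensor_poly (\<lambda>i. \<Sum>j = 0..n. smult (coeff (p i) j) (monom 1 j))"
    by simp
  also have "\<dots> = (\<Sum>F\<in>PiE UNIV (\<lambda>_. {0..n}).
      mpoly_scale (\<Prod>i\<in>UNIV. coeff (p i) (F i)) (tensor_poly (\<lambda>i. monom 1 (F i))))"
    by (rule tensor_poly_sum) simp
  also have "\<dots> \<in> tensor_polys n"
    unfolding tensor_polys_def
  proof (intro span_sum span_scale span_base CollectI exI conjI allI)
    fix F :: "'a \<Rightarrow> nat" and k assume F: "F \<in> PiE UNIV (\<lambda>_. {0..n})"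
    have l: "Poly_Mapping.lookup (Abs_poly_mapping F) = F"
      by (simp add: Abs_poly_mapping_inverse)
    show "tensor_poly (\<lambda>i. monom 1 (F i)) = Poly_Mapping.single (Abs_poly_mapping F) 1"
      by (simp add: single_eq_tensor_poly l)
    show "Poly_Mapping.lookup (Abs_poly_mapping F) k \<le> n"
      using F by (auto simp: l PiE_iff)
  qed
  finally show ?thesis .
qed

text \<open>
  A monomial is the tensor product of univariate monomials. Each of these is a combination of
  the given spanning polynomials of its variable, and multiplying out writes the monomial as a
  combination of their tensor products.
\<close>

lemma span_tensor_poly:
  assumes P: "\<And>i. module.span smult (P i ` {0..n}) = {p :: real poly. degree p \<le> n}"
    and inj: "\<And>i. inj_on (P i) {0..n}"
  shows "module.span mpoly_scale
      ((\<lambda>F. tensor_poly (\<lambda>i :: 'd::finite. P i (F i))) ` PiE UNIV (\<lambda>_. {0..n})) = tensor_polys n"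
    (is "module.span _ ?T = _")
proof -
  interpret u: vector_space "smult :: real \<Rightarrow> real poly \<Rightarrow> real poly"
    by (rule vector_space_smult)
  interpret vector_space "mpoly_scale :: real \<Rightarrow> 'd mpoly \<Rightarrow> 'd mpoly"
    by (rule vector_space_mpoly_scale)
  have deg: "degree (P i j) \<le> n" if "j \<le> n" for i j
    using u.span_base[of "P i j" "P i ` {0..n}"] P[of i] that by auto
  have "subspace (tensor_polys n)"
    unfolding tensor_polys_def by (rule subspace_span)
  moreover have "?T \<subseteq> tensor_polys n"
    by (auto intro!: tensor_poly_in_tensor_polys deg simp: PiE_iff)
  ultimately have "span ?T \<subseteq> tensor_polys n"
    by (simp add: span_minimal)
  moreover have "tensor_polys n \<subseteq> span ?T"
    unfolding tensor_polys_def
  proof (intro span_minimal subspace_span subsetI)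
    fix m :: "'d mpoly"
    assume "m \<in> {Poly_Mapping.single \<alpha> 1 |\<alpha>. \<forall>k. Poly_Mapping.lookup \<alpha> k \<le> n}"
    then obtain \<alpha> where \<alpha>: "\<And>k. Poly_Mapping.lookup \<alpha> k \<le> n"
      and m: "m = tensor_poly (\<lambda>i. monom 1 (Poly_Mapping.lookup \<alpha> i))"
      by (auto simp: single_eq_tensor_poly)
    have "\<exists>c. monom 1 (Poly_Mapping.lookup \<alpha> i) = (\<Sum>j = 0..n. smult (c j) (P i j))" for i
    proof -
      have "monom 1 (Poly_Mapping.lookup \<alpha> i) \<in> u.span (P i ` {0..n})"
        using P[of i] \<alpha>[of i] degree_monom_le[of "1::real" "Poly_Mapping.lookup \<alpha> i"] by auto
      then obtain u where "monom 1 (Poly_Mapping.lookup \<alpha> i) = (\<Sum>w\<in>P i ` {0..n}. smult (u w) w)"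
        using u.span_finite[of "P i ` {0..n}"] by auto
      then show ?thesis
        using inj[of i] by (auto simp: sum.reindex)
    qed
    then obtain c where
      "\<And>i. monom 1 (Poly_Mapping.lookup \<alpha> i) = (\<Sum>j = 0..n. smult (c i j) (P i j))"
      by metis
    then have "m = (\<Sum>F\<in>PiE UNIV (\<lambda>_. {0..n}).
        mpoly_scale (\<Prod>i\<in>UNIV. c i (F i)) (tensor_poly (\<lambda>i. P i (F i))))"
      unfolding m by (simp add: tensor_poly_sum)
    also have "\<dots> \<in> span ?T"
      by (intro span_sum span_scale span_base) auto
    finally show "m \<in> span ?T" .
  qed
  ultimately show ?thesis by blast
qed

section \<open>Integration against a product measure\<close>

text \<open>
  This converse of \<open>product_integrable_prod\<close> follows from Tonelli: the norms of the factors have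
  a finite product of integrals in \<open>[0, \<infinity>]\<close>, which bounds one of them only if the others do
  not vanish, since \<open>\<infinity> * 0 = 0\<close>.
\<close>

lemma (in product_sigma_finite) integrable_factor:
  fixes f :: "'i \<Rightarrow> 'a \<Rightarrow> real"
  assumes "finite I" "i \<in> I"
    and meas: "\<And>j. j \<in> I \<Longrightarrow> f j \<in> borel_measurable (M j)"
    and int: "integrable (Pi\<^sub>M I M) (\<lambda>x. \<Prod>j\<in>I. f j (x j))"
    and nz: "\<And>j. j \<in> I \<Longrightarrow> j \<noteq> i \<Longrightarrow> (\<integral>\<^sup>+ t. norm (f j t) \<partial>M j) \<noteq> 0"
  shows "integrable (M i) (f i)"
proof -
  have "(\<integral>\<^sup>+ x. (\<Prod>j\<in>I. ennreal (norm (f j (x j)))) \<partial>Pi\<^sub>M I M) \<noteq> \<infinity>"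
    using int unfolding integrable_iff_bounded prod_norm[symmetric] prod_ennreal[OF norm_ge_zero]
    by auto
  then have "(\<Prod>j\<in>I. \<integral>\<^sup>+ t. norm (f j t) \<partial>M j) \<noteq> \<infinity>"
    using product_nn_integral_prod[of I "\<lambda>j t. ennreal (norm (f j t))"] assms(1) meas by simp
  then have "(\<integral>\<^sup>+ t. norm (f i t) \<partial>M i) * (\<Prod>j\<in>I - {i}. \<integral>\<^sup>+ t. norm (f j t) \<partial>M j) \<noteq> \<infinity>"
    by (simp add: prod.remove[OF assms(1,2)])
  moreover have "(\<Prod>j\<in>I - {i}. \<integral>\<^sup>+ t. norm (f j t) \<partial>M j) \<noteq> 0"
    using assms(1) nz by auto
  ultimately have "(\<integral>\<^sup>+ t. norm (f i t) \<partial>M i) < \<infinity>"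
    by (auto simp: ennreal_mult_eq_top_iff less_top)
  then show ?thesis
    using meas[OF assms(2)] by (simp add: integrable_iff_bounded)
qed

context
  fixes \<nu> :: "'d::finite \<Rightarrow> real measure"
  assumes sets_factor: "\<And>i. sets (\<nu> i) = sets borel"
    and finite_factor: "\<And>i. finite_measure (\<nu> i)"
begin

lemma product_sigma_finite_factors: "product_sigma_finite \<nu>"
  using finite_factor by (auto simp: product_sigma_finite_def finite_measure_def)

lemma borel_measurable_factor: "f \<in> borel_measurable borel \<Longrightarrow> f \<in> borel_measurable (\<nu> i)"
  by (simp cong: measurable_cong_sets add: sets_factor)

lemma measurable_poly_factor: "poly p \<in> borel_measurable (\<nu> i)"
  by (intro borel_measurable_factor borel_measurable_continuous_onI) (intro continuous_intros)

lemma measurable_vec_lambda: "(\<lambda>f. \<chi> i. f i) \<in> measurable (PiM UNIV \<nu>) borel"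
proof -
  have "(\<lambda>f. f i) \<in> borel_measurable (PiM UNIV \<nu>)" for i
    using measurable_component_singleton[of i UNIV \<nu>]
    by (simp cong: measurable_cong_sets add: sets_factor)
  then show ?thesis
    by (subst borel_measurable_euclidean_space) (auto simp: Basis_vec_def inner_axis)
qed

lemma measurable_mpoly_eval: "mpoly_eval p \<in> borel_measurable borel"
  unfolding mpoly_eval_def[abs_def]
  by (intro borel_measurable_continuous_onI continuous_intros)

lemma integrable_tensor_poly_iff:
  "integrable (vec_product_measure \<nu>)
      (\<lambda>x. mpoly_eval (tensor_poly p) x * mpoly_eval (tensor_poly q) x)
    \<longleftrightarrow> integrable (PiM UNIV \<nu>) (\<lambda>f. \<Prod>i\<in>UNIV. poly (p i) (f i) * poly (q i) (f i))"
  unfolding vec_product_measure_def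
  by (subst integrable_distr_eq[OF measurable_vec_lambda
        borel_measurable_times[OF measurable_mpoly_eval measurable_mpoly_eval]])
     (simp add: mpoly_eval_tensor_poly prod.distrib)

lemma mpoly_ip_tensor_poly:
  assumes "\<And>i. integrable (\<nu> i) (\<lambda>t. poly (p i) t * poly (q i) t)"
  shows "mpoly_ip (vec_product_measure \<nu>) (tensor_poly p) (tensor_poly q) =
    (\<Prod>i\<in>UNIV. upoly_ip (\<nu> i) (p i) (q i))"
proof -
  interpret product_sigma_finite \<nu> by (rule product_sigma_finite_factors)
  have "mpoly_ip (vec_product_measure \<nu>) (tensor_poly p) (tensor_poly q) =
      (\<integral>f. (\<Prod>i\<in>UNIV. poly (p i) (f i) * poly (q i) (f i)) \<partial>PiM UNIV \<nu>)"
    unfolding mpoly_ip_def vec_product_measure_def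
    by (subst integral_distr[OF measurable_vec_lambda
          borel_measurable_times[OF measurable_mpoly_eval measurable_mpoly_eval]])
       (simp add: mpoly_eval_tensor_poly prod.distrib)
  also have "\<dots> = (\<Prod>i\<in>UNIV. upoly_ip (\<nu> i) (p i) (q i))"
    unfolding upoly_ip_def using assms by (intro product_integral_prod) auto
  finally show ?thesis .
qed

section \<open>The factors inherit the inner product\<close>

context
  assumes mpoly_ip: "mpoly_inner_product (vec_product_measure \<nu>)"
begin

lemma mpoly_ip_pos: "p \<noteq> 0 \<Longrightarrow> 0 < mpoly_ip (vec_product_measure \<nu>) p p"
  using mpoly_ip is_inner_productD(6) unfolding mpoly_inner_product_def by blast

text \<open>The squared norm of the constant 1 is positive and is the product of all the masses.\<close>

lemma factor_mass_nonzero: "emeasure (\<nu> i) (space (\<nu> i)) \<noteq> 0"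
proof
  assume "emeasure (\<nu> i) (space (\<nu> i)) = 0"
  then have "upoly_ip (\<nu> i) 1 1 = 0"
    by (simp add: upoly_ip_def measure_def)
  then have "(\<Prod>i\<in>UNIV. upoly_ip (\<nu> i) 1 1) = 0"
    by (intro prod_zero) auto
  moreover have "mpoly_ip (vec_product_measure \<nu>) (tensor_poly (\<lambda>_. 1)) (tensor_poly (\<lambda>_. 1)) =
      (\<Prod>i\<in>UNIV. upoly_ip (\<nu> i) 1 1)"
    by (rule mpoly_ip_tensor_poly) (simp add: finite_measure.integrable_const finite_factor)
  moreover have "0 < mpoly_ip (vec_product_measure \<nu>) (tensor_poly (\<lambda>_. 1)) (tensor_poly (\<lambda>_. 1))"
    by (intro mpoly_ip_pos tensor_poly_nonzero) simp
  ultimately show False by linarith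
qed

lemma integrable_poly_factor: "integrable (\<nu> i) (poly p)"
proof -
  interpret product_sigma_finite \<nu> by (rule product_sigma_finite_factors)
  let ?p = "\<lambda>j. if j = i then p else 1"
  have "integrable (PiM UNIV \<nu>) (\<lambda>f. \<Prod>j\<in>UNIV. poly (?p j) (f j))"
    using mpoly_ip integrable_tensor_poly_iff[of ?p "\<lambda>_. 1"]
    by (simp add: mpoly_inner_product_def)
  then have "integrable (\<nu> i) (poly (?p i))"
    using factor_mass_nonzero
    by (intro integrable_factor[where I = UNIV]) (auto intro: measurable_poly_factor)
  then show ?thesis by simp
qed

lemma integrable_poly_mult_factor: "integrable (\<nu> i) (\<lambda>t. poly p t * poly q t)"
  using integrable_poly_factor[of i "p * q"] unfolding poly_mult[abs_def] .

text \<open>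
  Additivity comes from integrability. Definiteness holds because the squared norm of a
  polynomial in the single variable \<open>x\<^sub>i\<close> with respect to the product measure is a multiple of
  its squared norm with respect to \<open>\<nu> i\<close>.
\<close>

lemma is_inner_product_factor: "is_inner_product smult (upoly_ip (\<nu> i))"
  unfolding is_inner_product_def
proof (intro conjI allI impI)
  fix p q r :: "real poly" and c :: real
  show "upoly_ip (\<nu> i) p q = upoly_ip (\<nu> i) q p"
    by (simp add: upoly_ip_def mult.commute)
  show "upoly_ip (\<nu> i) (p + q) r = upoly_ip (\<nu> i) p r + upoly_ip (\<nu> i) q r"
    by (simp add: upoly_ip_def distrib_right integrable_poly_mult_factor)
  show "upoly_ip (\<nu> i) (smult c p) q = c * upoly_ip (\<nu> i) p q"
    by (simp add: upoly_ip_def mult.assoc)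
next
  fix p :: "real poly" assume "p \<noteq> 0"
  let ?p = "\<lambda>j. if j = i then p else 1"
  have "0 < mpoly_ip (vec_product_measure \<nu>) (tensor_poly ?p) (tensor_poly ?p)"
    using \<open>p \<noteq> 0\<close> by (intro mpoly_ip_pos tensor_poly_nonzero) auto
  then have "(\<Prod>j\<in>UNIV. upoly_ip (\<nu> j) (?p j) (?p j)) \<noteq> 0"
    by (subst (asm) mpoly_ip_tensor_poly[OF integrable_poly_mult_factor]) linarith
  moreover have "(\<Prod>j\<in>UNIV. upoly_ip (\<nu> j) (?p j) (?p j)) = 0" if "upoly_ip (\<nu> i) p p = 0"
    using that by (intro prod_zero bexI[of _ i]) auto
  moreover have "0 \<le> upoly_ip (\<nu> i) p p"
    by (simp add: upoly_ip_def)
  ultimately show "0 < upoly_ip (\<nu> i) p p" by linarith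
qed

section \<open>The tensor basis\<close>

text \<open>
  The tensor products are naturally indexed by functions \<open>F\<close>; the enumeration \<open>h\<close> of these is
  there because \<open>orthonormal_basis\<close> has numbers as indices. Since a product of Kronecker deltas
  vanishes unless the two index functions agree everywhere, orthonormality carries over from
  the factors.
\<close>

lemma orthonormal_basis_tensor_poly:
  assumes P: "\<And>i. orthonormal_basis smult (upoly_ip (\<nu> i)) {p. degree p \<le> n} {0..n} (P i)"
    and h: "bij_betw h I (PiE UNIV (\<lambda>_. {0..n}))"
  shows "orthonormal_basis mpoly_scale (mpoly_ip (vec_product_measure \<nu>)) (tensor_polys n) I
    (\<lambda>k. tensor_poly (\<lambda>i. P i (h k i)))"
    (is "orthonormal_basis _ ?ip _ _ ?Q")
proof -
  have fin: "finite I"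
    using bij_betw_finite[OF h] by (simp add: finite_PiE)
  have h_le: "h k i \<le> n" if "k \<in> I" for k i
    using bij_betwE[OF h] that by (auto simp: PiE_iff)
  have orth: "\<forall>k\<in>I. \<forall>l\<in>I. ?ip (?Q k) (?Q l) = (if k = l then 1 else 0)"
  proof (intro ballI)
    fix k l assume kl: "k \<in> I" "l \<in> I"
    have "?ip (?Q k) (?Q l) = (\<Prod>i\<in>UNIV. upoly_ip (\<nu> i) (P i (h k i)) (P i (h l i)))"
      by (rule mpoly_ip_tensor_poly[OF integrable_poly_mult_factor])
    also have "\<dots> = (\<Prod>i\<in>UNIV. if h k i = h l i then 1 else 0)"
      using P h_le kl by (intro prod.cong) (auto simp: orthonormal_basis_def)
    also have "\<dots> = (if h k = h l then 1 else 0)"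
      by (auto simp: fun_eq_iff)
    also have "h k = h l \<longleftrightarrow> k = l"
      using h kl by (auto simp: bij_betw_def inj_on_eq_iff)
    finally show "?ip (?Q k) (?Q l) = (if k = l then 1 else 0)" .
  qed
  have "?Q ` I = (\<lambda>F. tensor_poly (\<lambda>i. P i (F i))) ` PiE UNIV (\<lambda>_. {0..n})"
    by (simp flip: bij_betw_imp_surj_on[OF h] add: image_image)
  then have "module.span mpoly_scale (?Q ` I) = tensor_polys n"
    using P span_tensor_poly[of P n] by (simp add: orthonormal_basis_def)
  then show ?thesis
    using orth orthonormal_independent[OF vector_space_mpoly_scale _ orth fin] mpoly_ip
    by (simp add: orthonormal_basis_def mpoly_inner_product_def)
qed

end

end

theorem proposition3p2:
  fixes \<nu> :: "'d::finite \<Rightarrow> real measure" and \<mu> :: "(real ^ 'd) measure"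
    and n :: nat and x :: "real ^ 'd"
  assumes "\<And>i. sets (\<nu> i) = sets borel"
    and "\<And>i. finite_measure (\<nu> i)"
    and "\<mu> = vec_product_measure \<nu>"
    and "mpoly_inner_product \<mu>"
  shows "tensor_christoffel \<mu> n x = (\<Prod>i\<in>UNIV. christoffel (\<nu> i) n (x $ i))"
proof -
  let ?I = "{1..(n + 1) ^ CARD('d)}" and ?F = "PiE (UNIV :: 'd set) (\<lambda>_. {0..n})"
  have ip: "mpoly_inner_product (vec_product_measure \<nu>)"
    using assms(3,4) by simp
  have uip: "is_inner_product smult (upoly_ip (\<nu> i))" for i
    by (rule is_inner_product_factor[OF assms(1,2) ip])
  obtain P where P: "\<And>i. orthonormal_basis smult (upoly_ip (\<nu> i)) {p. degree p \<le> n} {0..n} (P i)"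
    using christoffel_basis_exists[OF uip, of _ n] by metis
  have "card ?I = card ?F"
    by (simp add: card_PiE)
  then obtain h where h: "bij_betw h ?I ?F"
    using finite_same_card_bij[of ?I ?F] by (auto simp: finite_PiE)
  have "tensor_christoffel \<mu> n x = (\<Sum>k\<in>?I. (\<Prod>i\<in>UNIV. (poly (P i (h k i)) (x $ i))\<^sup>2))"
    using tensor_christoffel_eq[OF _ orthonormal_basis_tensor_poly[OF assms(1,2) ip P h], of x] ip
    by (simp add: assms(3) mpoly_inner_product_def mpoly_eval_tensor_poly prod_power_distrib)
  also have "\<dots> = (\<Sum>F\<in>?F. \<Prod>i\<in>UNIV. (poly (P i (F i)) (x $ i))\<^sup>2)"
    by (rule sum.reindex_bij_betw[OF h])
  also have "\<dots> = (\<Prod>i\<in>UNIV. \<Sum>j = 0..n. (poly (P i j) (x $ i))\<^sup>2)"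
    by (rule prod_sum_PiE[symmetric]) auto
  also have "\<dots> = (\<Prod>i\<in>UNIV. christoffel (\<nu> i) n (x $ i))"
    by (simp add: christoffel_eq[OF uip P])
  finally show ?thesis .
qed

end
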